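(* Let $n\geq 1$. Each of the following three functions $f:\{0,1\}^n\times\{0,1\}^n\to\{0,1\}$ satisfies $Q_1^*(f)\geq \frac n2-\frac12$: (i) the equality function, $\mathrm{EQ}(x,y)=1$ iff $x=y$; (ii) the disjointness function, $\mathrm{DISJ}(x,y)=1$ iff $|x\wedge y|=0$, i.e. there is no index $i$ with $x_i=y_i=1$; (iii) the greater-than function, $\mathrm{GT}(x,y)=1$ iff $y\geq x$, where strings are compared as $n$-bit binary integers.
   Context: Quantum protocols with prior entanglement. Alice receives $x\in X$, Bob receives $y\in Y$ (here $X=Y=\{0,1\}^n$). A $q$-qubit protocol ($q\ge 1$) starts in a fixed state (independent of the inputs) on finite-dimensional registers, some held by Alice and the others by Bob; this state may be arbitrarily entangled between them and may include local ancillas of any finite dimension. There are $q$ rounds. In round $t$, a designated sender (depending only on $t$) applies a unitary, depending on $t$ and on the sender's own input, to all registers the sender currently holds, and then transfers one designated qubit to the other party. The output is the result of measuring the last transferred qubit in the computational basis. One-sided-error complexity. $Q_1^*(f)$ is the minimal $q$ for which some $q$-qubit protocol with prior entanglement outputs 1 with probability $0$ on every $(x,y)$ with $f(x,y)=0$, and outputs 1 with probability at least $1/2$ on every $(x,y)$ with $f(x,y)=1$. *)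

theory Defs
  imports Complex_Main "HOL-Library.FuncSet" "HOL-Library.Extended_Real"
begin

section \<open>Quantum protocols with prior entanglement\<close>

text \<open>
  The registers of a protocol are named by natural numbers; register \<open>r\<close> has the computational
  basis \<open>{..<d r}\<close>.  A joint basis state of a set \<open>S\<close> of registers is a function in
  \<open>basis d S\<close>, a state vector is its amplitude function (only the values on \<open>basis d S\<close> matter),
  and an operator on the registers in \<open>S\<close> is a matrix indexed by \<open>basis d S\<close>, row index first.
\<close>

definition basis :: "(nat \<Rightarrow> nat) \<Rightarrow> nat set \<Rightarrow> (nat \<Rightarrow> nat) set" where
  "basis d S = (\<Pi>\<^sub>E r\<in>S. {..<d r})"

type_synonym state = "(nat \<Rightarrow> nat) \<Rightarrow> complex"
type_synonym gate = "(nat \<Rightarrow> nat) \<Rightarrow> (nat \<Rightarrow> nat) \<Rightarrow> complex"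

definition unit_vector_on :: "'c set \<Rightarrow> ('c \<Rightarrow> complex) \<Rightarrow> bool" where
  "unit_vector_on B \<psi> \<longleftrightarrow> (\<Sum>c\<in>B. (cmod (\<psi> c))\<^sup>2) = 1"

definition unitary_on :: "'c set \<Rightarrow> ('c \<Rightarrow> 'c \<Rightarrow> complex) \<Rightarrow> bool" where
  "unitary_on B U \<longleftrightarrow>
     (\<forall>i\<in>B. \<forall>j\<in>B. (\<Sum>k\<in>B. cnj (U k i) * U k j) = (if i = j then 1 else 0)) \<and>
     (\<forall>i\<in>B. \<forall>j\<in>B. (\<Sum>k\<in>B. U i k * cnj (U j k)) = (if i = j then 1 else 0))"

text \<open>The operator \<open>U\<close> on the registers in \<open>S\<close>, tensored with the identity on all other registers.\<close>

definition apply_gate :: "(nat \<Rightarrow> nat) \<Rightarrow> nat set \<Rightarrow> gate \<Rightarrow> state \<Rightarrow> state" where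
  "apply_gate d S U \<psi> = (\<lambda>c. \<Sum>b\<in>basis d S. U (restrict c S) b * \<psi> (override_on c b S))"

datatype party = Alice | Bob

text \<open>
  Rounds are numbered \<open>0, \<dots>, rounds P - 1\<close>.  In round \<open>t\<close> the party \<open>sender P t\<close> applies
  \<open>alice_gate P t x\<close> or \<open>bob_gate P t y\<close> and then sends the register \<open>message P t\<close>.
  \<open>alice_init P\<close> is the set of registers initially held by Alice; Bob holds the remaining ones.
  The initial state is an arbitrary unit vector; mixed initial states are covered by purification,
  as there is no bound on the registers that a party may hold.
\<close>

record ('x, 'y) protocol =
  rounds :: nat
  registers :: "nat set"
  reg_dim :: "nat \<Rightarrow> nat"
  alice_init :: "nat set"
  init_state :: state
  sender :: "nat \<Rightarrow> party"
  message :: "nat \<Rightarrow> nat"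
  alice_gate :: "nat \<Rightarrow> 'x \<Rightarrow> gate"
  bob_gate :: "nat \<Rightarrow> 'y \<Rightarrow> gate"

primrec alice_regs :: "('x, 'y) protocol \<Rightarrow> nat \<Rightarrow> nat set" where
  "alice_regs P 0 = alice_init P"
| "alice_regs P (Suc t) =
     (case sender P t of
        Alice \<Rightarrow> alice_regs P t - {message P t}
      | Bob \<Rightarrow> insert (message P t) (alice_regs P t))"

definition sender_regs :: "('x, 'y) protocol \<Rightarrow> nat \<Rightarrow> nat set" where
  "sender_regs P t =
     (case sender P t of
        Alice \<Rightarrow> alice_regs P t
      | Bob \<Rightarrow> registers P - alice_regs P t)"

definition round_gate :: "('x, 'y) protocol \<Rightarrow> 'x \<Rightarrow> 'y \<Rightarrow> nat \<Rightarrow> gate" where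
  "round_gate P x y t =
     (case sender P t of
        Alice \<Rightarrow> alice_gate P t x
      | Bob \<Rightarrow> bob_gate P t y)"

definition valid_protocol :: "'x set \<Rightarrow> 'y set \<Rightarrow> ('x, 'y) protocol \<Rightarrow> bool" where
  "valid_protocol X Y P \<longleftrightarrow>
     rounds P \<ge> 1 \<and>
     finite (registers P) \<and>
     (\<forall>r\<in>registers P. reg_dim P r \<ge> 1) \<and>
     alice_init P \<subseteq> registers P \<and>
     unit_vector_on (basis (reg_dim P) (registers P)) (init_state P) \<and>
     (\<forall>t<rounds P.
        message P t \<in> sender_regs P t \<and>
        reg_dim P (message P t) = 2 \<and>
        (\<forall>x\<in>X. \<forall>y\<in>Y. unitary_on (basis (reg_dim P) (sender_regs P t)) (round_gate P x y t)))"

primrec run :: "('x, 'y) protocol \<Rightarrow> 'x \<Rightarrow> 'y \<Rightarrow> nat \<Rightarrow> state" where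
  "run P x y 0 = init_state P"
| "run P x y (Suc t) =
     apply_gate (reg_dim P) (sender_regs P t) (round_gate P x y t) (run P x y t)"

definition prob_output_1 :: "('x, 'y) protocol \<Rightarrow> 'x \<Rightarrow> 'y \<Rightarrow> real" where
  "prob_output_1 P x y =
     (\<Sum>c\<in>{c \<in> basis (reg_dim P) (registers P). c (message P (rounds P - 1)) = 1}.
        (cmod (run P x y (rounds P) c))\<^sup>2)"

definition computes_one_sided ::
    "'x set \<Rightarrow> 'y set \<Rightarrow> ('x \<Rightarrow> 'y \<Rightarrow> bool) \<Rightarrow> ('x, 'y) protocol \<Rightarrow> bool" where
  "computes_one_sided X Y f P \<longleftrightarrow>
     (\<forall>x\<in>X. \<forall>y\<in>Y.
        (\<not> f x y \<longrightarrow> prob_output_1 P x y = 0) \<and>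
        (f x y \<longrightarrow> prob_output_1 P x y \<ge> 1 / 2))"

text \<open>An infimum in \<^typ>\<open>enat\<close> is attained whenever the set is nonempty.\<close>

definition Q1_star :: "'x set \<Rightarrow> 'y set \<Rightarrow> ('x \<Rightarrow> 'y \<Rightarrow> bool) \<Rightarrow> enat" where
  "Q1_star X Y f =
     Inf {enat (rounds P) | P. valid_protocol X Y P \<and> computes_one_sided X Y f P}"

section \<open>The functions\<close>

definition bitstrings :: "nat \<Rightarrow> bool list set" where
  "bitstrings n = {xs. length xs = n}"

definition EQ :: "bool list \<Rightarrow> bool list \<Rightarrow> bool" where
  "EQ x y \<longleftrightarrow> x = y"

definition DISJ :: "bool list \<Rightarrow> bool list \<Rightarrow> bool" where
  "DISJ x y \<longleftrightarrow> \<not> (\<exists>i. i < length x \<and> i < length y \<and> x ! i \<and> y ! i)"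

text \<open>Most significant bit first; \<^const>\<open>horner_sum\<close> reads the least significant one first.\<close>

definition binary_value :: "bool list \<Rightarrow> nat" where
  "binary_value xs = horner_sum of_bool 2 (rev xs)"

definition GT :: "bool list \<Rightarrow> bool list \<Rightarrow> bool" where
  "GT x y \<longleftrightarrow> binary_value y \<ge> binary_value x"

end

theory Submission
  imports Defs "HOL-Library.Disjoint_Sets"
begin

text \<open>
  Replace each transmitted qubit by an unnormalised maximally entangled pair: the sender projects the
  qubit together with one half of the pair onto the pair, and the receiver keeps the other half.
  The final amplitudes of a \<open>q\<close>-qubit protocol then become \<open>(A\<^sub>x \<otimes> B\<^sub>y) \<Psi>\<close>,
  where each round multiplies \<open>\<parallel>A\<^sub>x\<parallel>\<^sup>2 \<parallel>B\<^sub>y\<parallel>\<^sup>2 \<parallel>\<Psi>\<parallel>\<^sup>2\<close> by \<open>4\<close>.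
  For each of the three functions there are \<open>N = 2\<^sup>n\<close> pairs \<open>(x\<^sub>k, y\<^sub>k)\<close> with \<open>f x\<^sub>k y\<^sub>k\<close>, but
  \<open>\<not> f x\<^sub>k y\<^sub>l\<close> for \<open>l < k\<close>. Hence \<open>A\<^sub>k \<Psi>\<close> lies, on Bob's side, in \<open>L\<^sub>k\<close>, the intersection of the kernels
  of the \<open>B\<^sub>l\<close> with \<open>l < k\<close>, and \<open>B\<^sub>k\<close> sees only its component in \<open>L\<^sub>k \<ominus> L\<^sub>k\<^sub>+\<^sub>1\<close>. These subspaces are mutually
  orthogonal, and the component of \<open>\<Psi>\<close> in each of them has squared norm at least
  \<open>1/2 / (\<parallel>A\<parallel>\<^sup>2 \<parallel>B\<parallel>\<^sup>2)\<close>, so that \<open>N / 2 \<le> 4\<^sup>q\<close>.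
\<close>

section \<open>Orthonormal families\<close>

definition cinner :: "'c set \<Rightarrow> ('c \<Rightarrow> complex) \<Rightarrow> ('c \<Rightarrow> complex) \<Rightarrow> complex" where
  "cinner B u v = (\<Sum>c\<in>B. cnj (u c) * v c)"

definition sqnorm :: "'c set \<Rightarrow> ('c \<Rightarrow> complex) \<Rightarrow> real" where
  "sqnorm B u = (\<Sum>c\<in>B. (cmod (u c))\<^sup>2)"

definition orthonormal :: "'c set \<Rightarrow> ('c \<Rightarrow> complex) set \<Rightarrow> bool" where
  "orthonormal B S \<longleftrightarrow> (\<forall>g\<in>S. \<forall>h\<in>S. cinner B g h = (if g = h then 1 else 0))"

definition proj :: "'c set \<Rightarrow> ('c \<Rightarrow> complex) set \<Rightarrow> ('c \<Rightarrow> complex) \<Rightarrow> 'c \<Rightarrow> complex" where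
  "proj B S u c = (\<Sum>g\<in>S. cinner B g u * g c)"

lemma of_real_sqnorm: "complex_of_real (sqnorm B u) = cinner B u u"
  by (simp add: sqnorm_def cinner_def complex_norm_square mult.commute
      flip: of_real_power)

lemma sqnorm_nonneg: "0 \<le> sqnorm B u"
  by (simp add: sqnorm_def sum_nonneg)

lemma cnj_cinner: "cnj (cinner B u v) = cinner B v u"
  by (simp add: cinner_def mult.commute)

lemma cinner_diff_right: "cinner B u (\<lambda>c. v c - w c) = cinner B u v - cinner B u w"
  by (simp add: cinner_def right_diff_distrib sum_subtractf)

lemma cinner_diff_left: "cinner B (\<lambda>c. v c - w c) u = cinner B v u - cinner B w u"
  by (simp add: cinner_def left_diff_distrib sum_subtractf)

lemma cinner_scale_left: "cinner B (\<lambda>c. k * u c) v = cnj k * cinner B u v"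
  by (simp add: cinner_def sum_distrib_left mult.assoc)

lemma cinner_scale_right: "cinner B u (\<lambda>c. k * v c) = k * cinner B u v"
  by (simp add: cinner_def sum_distrib_left mult.left_commute)

lemma cinner_proj_right: "cinner B v (proj B S u) = (\<Sum>g\<in>S. cinner B g u * cinner B v g)"
  unfolding proj_def cinner_def sum_distrib_left
  by (subst sum.swap) (simp add: mult_ac)

lemma cinner_proj_left: "cinner B (proj B S u) v = (\<Sum>g\<in>S. cinner B u g * cinner B g v)"
  using arg_cong[OF cinner_proj_right[of B v S u], of cnj]
  by (simp add: cnj_cinner)

text \<open>The set \<open>S'\<close> may be smaller than \<open>S\<close>: a projection onto one
  block of an orthonormal family is later tested against members of the other blocks, where it must
  vanish.\<close>

lemma cinner_proj_member:
  assumes "orthonormal B S" "finite S" "S' \<subseteq> S" "g \<in> S"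
  shows "cinner B g (proj B S' u) = (if g \<in> S' then cinner B g u else 0)"
proof -
  have "finite S'" using assms finite_subset by blast
  have "(\<Sum>h\<in>S'. cinner B h u * cinner B g h) = (\<Sum>h\<in>S'. if g = h then cinner B h u else 0)"
    using assms by (intro sum.cong) (auto simp: orthonormal_def)
  then show ?thesis
    using \<open>finite S'\<close> by (simp add: cinner_proj_right)
qed

lemma sqnorm_proj:
  assumes "orthonormal B S" "finite S"
  shows "sqnorm B (proj B S u) = (\<Sum>g\<in>S. (cmod (cinner B g u))\<^sup>2)"
proof -
  have "complex_of_real (sqnorm B (proj B S u)) = (\<Sum>g\<in>S. cinner B u g * cinner B g u)"
    using cinner_proj_member[OF assms order_refl]
    by (simp add: of_real_sqnorm cinner_proj_left)
  also have "\<dots> = complex_of_real (\<Sum>g\<in>S. (cmod (cinner B g u))\<^sup>2)"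
    by (simp add: complex_norm_square cnj_cinner mult.commute flip: of_real_power)
  finally show ?thesis using of_real_eq_iff by blast
qed

text \<open>With \<open>p\<close> the projection of \<open>u\<close>,
  \<open>cinner B u p = cinner B p p\<close>. Hence the squared norm of \<open>u - p\<close> is
  \<open>sqnorm B u - sqnorm B p\<close>, and it is nonnegative.\<close>

lemma bessel:
  assumes "orthonormal B S" "finite S"
  shows "(\<Sum>g\<in>S. (cmod (cinner B g u))\<^sup>2) \<le> sqnorm B u"
proof -
  define p where "p = proj B S u"
  have 1: "cinner B p p = cinner B p u"
    using cinner_proj_member[OF assms order_refl] by (simp add: p_def cinner_proj_left)
  then have 2: "cinner B u p = cinner B p p"
    by (metis cnj_cinner)
  have "complex_of_real (sqnorm B (\<lambda>c. u c - p c)) = complex_of_real (sqnorm B u - sqnorm B p)"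
    using 1 2 by (simp add: of_real_sqnorm cinner_diff_left cinner_diff_right)
  then have "sqnorm B (\<lambda>c. u c - p c) = sqnorm B u - sqnorm B p"
    using of_real_eq_iff by blast
  then show ?thesis
    using sqnorm_nonneg[of B "\<lambda>c. u c - p c"] sqnorm_proj[OF assms, of u] by (simp add: p_def)
qed

text \<open>\<open>T\<close> extends \<open>S\<close> to an orthonormal family whose span is that of \<open>S \<union> R\<close>; the span condition is
  stated through orthogonal complements.\<close>

definition extends :: "'c set \<Rightarrow> ('c \<Rightarrow> complex) set \<Rightarrow> ('c \<Rightarrow> complex) set \<Rightarrow> ('c \<Rightarrow> complex) set \<Rightarrow> bool" where
  "extends B S R T \<longleftrightarrow> finite T \<and> S \<inter> T = {} \<and> orthonormal B (S \<union> T) \<and>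
    (\<forall>u. (\<forall>g\<in>S. cinner B g u = 0) \<longrightarrow>
      (\<forall>r\<in>R. cinner B r u = 0) = (\<forall>g\<in>T. cinner B g u = 0))"

lemma extendsD:
  assumes "extends B S R T"
  shows "finite T" "S \<inter> T = {}" "orthonormal B (S \<union> T)"
    "(\<And>g. g \<in> S \<Longrightarrow> cinner B g u = 0) \<Longrightarrow>
      (\<forall>r\<in>R. cinner B r u = 0) = (\<forall>g\<in>T. cinner B g u = 0)"
  using assms by (simp_all add: extends_def)

text \<open>One Gram-Schmidt step: the residual \<open>w\<close> of \<open>v\<close> after
  projection is normalised to a single new vector, or dropped if its norm is zero.\<close>

lemma orthonormal_extend_vector:
  assumes "finite B" "orthonormal B S" "finite S"
  shows "\<exists>T. extends B S {v} T"
proof -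
  define w where "w = (\<lambda>c. v c - proj B S v c)"
  have proj0: "cinner B (proj B S v) u = 0" if "\<forall>g\<in>S. cinner B g u = 0" for u
    using that by (simp add: cinner_proj_left)
  have wv: "cinner B w u = cinner B v u" if "\<forall>g\<in>S. cinner B g u = 0" for u
    using proj0[OF that] by (simp add: w_def cinner_diff_left)
  have gw: "cinner B g w = 0" if "g \<in> S" for g
    using cinner_proj_member[OF assms(2,3) order_refl that]
    by (simp add: w_def cinner_diff_right that)
  show ?thesis
  proof (cases "sqnorm B w = 0")
    case True
    then have "w c = 0" if "c \<in> B" for c
      using that assms(1) by (simp add: sqnorm_def sum_nonneg_eq_0_iff)
    then have "cinner B w u = 0" for u
      by (simp add: cinner_def)
    with wv have "cinner B v u = 0" if "\<forall>g\<in>S. cinner B g u = 0" for u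
      using that by metis
    then show ?thesis
      using assms by (intro exI[of _ "{}"]) (simp add: extends_def)
  next
    case False
    define k where "k = complex_of_real (1 / sqrt (sqnorm B w))"
    define h where "h = (\<lambda>c. k * w c)"
    have k0: "k \<noteq> 0" and kk: "cnj k * k * complex_of_real (sqnorm B w) = 1"
      using False sqnorm_nonneg[of B w]
      by (auto simp: k_def simp flip: of_real_mult)
    have hh: "cinner B h h = 1"
      using kk by (simp add: h_def cinner_scale_left cinner_scale_right of_real_sqnorm mult_ac)
    have gh: "cinner B g h = 0" if "g \<in> S" for g
      using gw[OF that] by (simp add: h_def cinner_scale_right)
    then have hg: "cinner B h g = 0" if "g \<in> S" for g
      using that by (metis cnj_cinner complex_cnj_zero)
    have "h \<notin> S" using gh hh by force
    have "cinner B h u = cnj k * cinner B v u" if "\<forall>g\<in>S. cinner B g u = 0" for u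
      using wv[OF that] by (simp add: h_def cinner_scale_left)
    moreover have "orthonormal B (S \<union> {h})"
      using assms(2) hh gh hg \<open>h \<notin> S\<close> by (auto simp: orthonormal_def)
    ultimately show ?thesis
      using \<open>h \<notin> S\<close> k0 by (intro exI[of _ "{h}"]) (simp add: extends_def)
  qed
qed

text \<open>Gram-Schmidt, one vector of \<open>R\<close> at a time; the family
  \<open>S \<union> T\<close> built so far becomes the base for the next vector.\<close>

lemma orthonormal_extend:
  assumes "finite B" "orthonormal B S" "finite S" "finite R"
  shows "\<exists>T. extends B S R T"
  using assms(4)
proof induction
  case empty
  show ?case using assms by (intro exI[of _ "{}"]) (simp add: extends_def)
next
  case (insert v R)
  then obtain T where "extends B S R T" by blast
  note T = extendsD[OF this]
  have "finite (S \<union> T)" using assms(3) T(1) by simp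
  from orthonormal_extend_vector[OF assms(1) T(3) this, of v]
  obtain T' where "extends B (S \<union> T) {v} T'" by blast
  note T' = extendsD[OF this]
  have "(\<forall>r\<in>insert v R. cinner B r u = 0) = (\<forall>g\<in>T \<union> T'. cinner B g u = 0)"
    if u: "\<forall>g\<in>S. cinner B g u = 0" for u
  \<comment> \<open>\<open>T'(4)\<close> speaks only about vectors orthogonal to
    \<open>S \<union> T\<close>. If \<open>u\<close> is not orthogonal to \<open>T\<close>, both
    sides already fail.\<close>
  proof (cases "\<forall>g\<in>T. cinner B g u = 0")
    case True
    then have "(\<forall>r\<in>{v}. cinner B r u = 0) = (\<forall>g\<in>T'. cinner B g u = 0)"
      using u by (intro T'(4)) auto
    then show ?thesis using T(4)[of u] u True by auto
  next
    case False
    then show ?thesis using T(4)[of u] u by auto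
  qed
  then have "extends B S (insert v R) (T \<union> T')"
    using T(1,2) T'(1-3) by (simp add: extends_def Int_Un_distrib Int_Un_distrib2 Un_assoc)
  then show ?case by blast
qed

text \<open>The last two conditions say that \<open>S 0, ..., S k\<close> and
  \<open>R 0, ..., R k\<close> have the same orthogonal complement for every \<open>k < N\<close>.
  Let \<open>L k\<close> denote the complement of all \<open>R l\<close> with \<open>l < k\<close>;
  then, for finite \<open>B\<close>, \<open>S k\<close> is an orthonormal basis of the part of
  \<open>L k\<close> orthogonal to \<open>L (k + 1)\<close>. Disjointness lets sums over the union
  split by block.\<close>

definition adapted_flag ::
    "'c set \<Rightarrow> (nat \<Rightarrow> ('c \<Rightarrow> complex) set) \<Rightarrow> nat \<Rightarrow> (nat \<Rightarrow> ('c \<Rightarrow> complex) set) \<Rightarrow> bool" where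
  "adapted_flag B R N S \<longleftrightarrow>
    (\<forall>k<N. finite (S k)) \<and> disjoint_family_on S {..<N} \<and> orthonormal B (\<Union>k<N. S k) \<and>
    (\<forall>k<N. \<forall>u. (\<forall>l\<le>k. \<forall>g\<in>S l. cinner B g u = 0) \<longrightarrow> (\<forall>r\<in>R k. cinner B r u = 0)) \<and>
    (\<forall>k<N. \<forall>u. (\<forall>l\<le>k. \<forall>r\<in>R l. cinner B r u = 0) \<longrightarrow> (\<forall>g\<in>S k. cinner B g u = 0))"

lemma adapted_flagD:
  assumes "adapted_flag B R N S"
  shows "k < N \<Longrightarrow> finite (S k)" "disjoint_family_on S {..<N}" "orthonormal B (\<Union>k<N. S k)"
    "k < N \<Longrightarrow> (\<forall>l\<le>k. \<forall>g\<in>S l. cinner B g u = 0) \<Longrightarrow> (\<forall>r\<in>R k. cinner B r u = 0)"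
    "k < N \<Longrightarrow> (\<forall>l\<le>k. \<forall>r\<in>R l. cinner B r u = 0) \<Longrightarrow> (\<forall>g\<in>S k. cinner B g u = 0)"
proof -
  note * = assms[unfolded adapted_flag_def]
  show "k < N \<Longrightarrow> finite (S k)" "disjoint_family_on S {..<N}" "orthonormal B (\<Union>k<N. S k)"
    using * by auto
  show "k < N \<Longrightarrow> (\<forall>l\<le>k. \<forall>g\<in>S l. cinner B g u = 0) \<Longrightarrow> (\<forall>r\<in>R k. cinner B r u = 0)"
    using *[THEN conjunct2, THEN conjunct2, THEN conjunct2, THEN conjunct1] by metis
  show "k < N \<Longrightarrow> (\<forall>l\<le>k. \<forall>r\<in>R l. cinner B r u = 0) \<Longrightarrow> (\<forall>g\<in>S k. cinner B g u = 0)"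
    using *[THEN conjunct2, THEN conjunct2, THEN conjunct2, THEN conjunct2] by metis
qed

text \<open>The block for \<open>N\<close> is the Gram-Schmidt extension of the union of all earlier
  blocks by \<open>R N\<close>, so earlier blocks are never revised.\<close>

lemma orthonormal_flag:
  fixes R :: "nat \<Rightarrow> ('c \<Rightarrow> complex) set"
  assumes "finite B" "\<And>k. finite (R k)"
  shows "\<exists>S. adapted_flag B R N S"
proof (induction N)
  case 0
  show ?case by (simp add: adapted_flag_def orthonormal_def disjoint_family_on_def)
next
  case (Suc N)
  then obtain S where "adapted_flag B R N S" by blast
  note S = adapted_flagD[OF this]
  have "finite (\<Union>k<N. S k)" using S(1) by simp
  from orthonormal_extend[OF assms(1) S(3) this assms(2)]
  obtain T where "extends B (\<Union>k<N. S k) (R N) T" by blast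
  note T = extendsD[OF this]
  let ?S = "S(N := T)"
  have eq: "(\<Union>k<Suc N. ?S k) = (\<Union>k<N. S k) \<union> T"
    by (auto simp: lessThan_Suc)
  show ?case
    unfolding adapted_flag_def
  proof (intro exI[of _ ?S] conjI allI impI)
    show "finite (?S k)" if "k < Suc N" for k
      using that S(1) T(1) by auto
    show "disjoint_family_on ?S {..<Suc N}"
      unfolding disjoint_family_on_def
    proof (intro ballI impI)
      fix k l assume kl: "k \<in> {..<Suc N}" "l \<in> {..<Suc N}" "k \<noteq> l"
      have T': "S m \<inter> T = {}" if "m < N" for m
        using T(2) that by blast
      show "?S k \<inter> ?S l = {}"
      proof (cases "k = N \<or> l = N")
        case True
        then show ?thesis using T' kl by (auto simp: less_Suc_eq)
      next
        case False
        then show ?thesis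
          using S(2) kl by (simp add: disjoint_family_on_def less_Suc_eq)
      qed
    qed
    show "orthonormal B (\<Union>k<Suc N. ?S k)"
      using T(3) by (simp only: eq)
    fix k u assume k: "k < Suc N"
    show "\<forall>r\<in>R k. cinner B r u = 0" if u: "\<forall>l\<le>k. \<forall>g\<in>?S l. cinner B g u = 0"
    proof (cases "k = N")
      case True
      have "cinner B g u = 0" if "g \<in> (\<Union>k<N. S k)" for g
        using that u True by (metis UN_E fun_upd_other lessThan_iff less_imp_le nat_neq_iff)
      moreover have "\<forall>g\<in>T. cinner B g u = 0"
        using u True by (metis fun_upd_same order_refl)
      ultimately show ?thesis using T(4)[of u] True by blast
    next
      case False
      then have "k < N" using k by simp
      moreover have "\<forall>l\<le>k. \<forall>g\<in>S l. cinner B g u = 0"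
        using u \<open>k < N\<close> by (metis fun_upd_other leD)
      ultimately show ?thesis using S(4) by blast
    qed
    show "\<forall>g\<in>?S k. cinner B g u = 0" if u: "\<forall>l\<le>k. \<forall>r\<in>R l. cinner B r u = 0"
    proof (cases "k = N")
      case True
      \<comment> \<open>\<open>extends\<close> describes \<open>T\<close> only on vectors orthogonal
        to all earlier blocks; this orthogonality follows from the assumption on \<open>R\<close>
        through the induction hypothesis.\<close>
      have "\<forall>g\<in>(\<Union>k<N. S k). cinner B g u = 0"
      proof
        fix g assume "g \<in> (\<Union>k<N. S k)"
        then obtain l where l: "l < N" "g \<in> S l" by blast
        have "\<forall>l'\<le>l. \<forall>r\<in>R l'. cinner B r u = 0"
          using u True l(1) by (meson le_trans less_imp_le)
        then show "cinner B g u = 0" using S(5)[OF l(1)] l(2) by blast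
      qed
      then show ?thesis using T(4)[of u] u True by auto
    next
      case False
      then show ?thesis using S(5)[of k u] u k by auto
    qed
  qed
qed

section \<open>Triangular families of tensor products\<close>

text \<open>\<open>K\<close> bounds the square of the operator norm.\<close>

definition op_bound :: "'b set \<Rightarrow> 'i set \<Rightarrow> ('b \<Rightarrow> 'i \<Rightarrow> complex) \<Rightarrow> real \<Rightarrow> bool" where
  "op_bound B I M K \<longleftrightarrow> (\<forall>u. sqnorm B (\<lambda>b. \<Sum>i\<in>I. M b i * u i) \<le> K * sqnorm I u)"

lemma op_boundD: "op_bound B I M K \<Longrightarrow> sqnorm B (\<lambda>b. \<Sum>i\<in>I. M b i * u i) \<le> K * sqnorm I u"
  by (simp add: op_bound_def)

text \<open>The \<open>N\<close> lower bounds concern mutually orthogonal components of the same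
  tensor, so Bessel's inequality charges all of them to a single squared norm of
  \<open>\<Psi>\<close>. This is where the factor \<open>N\<close> is gained.\<close>

lemma triangular_bound:
  fixes a :: "nat \<Rightarrow> 'a \<Rightarrow> 'i \<Rightarrow> complex" and b :: "nat \<Rightarrow> 'b \<Rightarrow> 'j \<Rightarrow> complex"
  assumes fin: "finite A" "finite B" "finite I" "finite J"
    and K: "0 \<le> KA" "0 \<le> KB"
    and a: "\<And>k. k < N \<Longrightarrow> op_bound A I (a k) KA"
    and b: "\<And>k. k < N \<Longrightarrow> op_bound B J (b k) KB"
    and zero: "\<And>k l x y. k < N \<Longrightarrow> l < k \<Longrightarrow> x \<in> A \<Longrightarrow> y \<in> B \<Longrightarrow>
      (\<Sum>i\<in>I. \<Sum>j\<in>J. a k x i * b l y j * \<Psi> i j) = 0"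
    and diag: "\<And>k. k < N \<Longrightarrow>
      \<epsilon> \<le> (\<Sum>x\<in>A. \<Sum>y\<in>B. (cmod (\<Sum>i\<in>I. \<Sum>j\<in>J. a k x i * b k y j * \<Psi> i j))\<^sup>2)"
  shows "real N * \<epsilon> \<le> KA * KB * (\<Sum>i\<in>I. sqnorm J (\<Psi> i))"
proof -
  \<comment> \<open>\<open>cinner\<close> conjugates its left argument, so the rows are conjugated
    here: orthogonality to \<open>R k\<close> is membership in the kernel of
    \<open>b k\<close>.\<close>
  define R where "R = (\<lambda>k. (\<lambda>y j. cnj (b k y j)) ` B)"
  \<comment> \<open>\<open>X k x\<close> is the vector left on the \<open>J\<close> side once
    \<open>a k\<close> has acted on the \<open>I\<close> side and its output is fixed to
    \<open>x\<close>.\<close>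
  define X where "X = (\<lambda>k x j. \<Sum>i\<in>I. a k x i * \<Psi> i j)"
  have row: "cinner J (\<lambda>j. cnj (b k y j)) u = (\<Sum>j\<in>J. b k y j * u j)" for k y u
    by (simp add: cinner_def)
  have bX: "(\<Sum>j\<in>J. b l y j * X k x j) = (\<Sum>i\<in>I. \<Sum>j\<in>J. a k x i * b l y j * \<Psi> i j)" for k l x y
    unfolding X_def sum_distrib_left by (subst sum.swap) (simp add: mult_ac)
  have gX: "cinner J g (X k x) = (\<Sum>i\<in>I. a k x i * cinner J g (\<Psi> i))" for g k x
    unfolding X_def sum_distrib_left cinner_def by (subst sum.swap) (simp add: mult_ac)
  have "\<And>k. finite (R k)" using fin by (simp add: R_def)
  from orthonormal_flag[OF fin(4), of R N, OF this]
  obtain S where "adapted_flag J R N S" by blast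
  note S = adapted_flagD[OF this]
  let ?U = "\<Union>k<N. S k"
  have finU: "finite ?U" using S(1) by blast
  have orth: "orthonormal J (S k)" if "k < N" for k
    using S(3) that by (auto simp: orthonormal_def)
  have step: "\<epsilon> \<le> KA * KB * (\<Sum>g\<in>S k. \<Sum>i\<in>I. (cmod (cinner J g (\<Psi> i)))\<^sup>2)" if k: "k < N" for k
  proof -
    \<comment> \<open>By \<open>zero\<close>, \<open>X k x\<close> lies in the kernel of every
      \<open>b l\<close> with \<open>l < k\<close>, hence is orthogonal to all earlier
      blocks.\<close>
    have low: "cinner J g (X k x) = 0" if "l < k" "g \<in> S l" "x \<in> A" for l g x
    proof -
      have "\<forall>l'\<le>l. \<forall>r\<in>R l'. cinner J r (X k x) = 0"
        using zero k that by (auto simp: R_def row bX)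
      then show ?thesis using S(5)[of l "X k x"] that k by auto
    qed
    have kill: "(\<Sum>j\<in>J. b k y j * X k x j) = (\<Sum>j\<in>J. b k y j * proj J (S k) (X k x) j)"
      if "x \<in> A" "y \<in> B" for x y
    proof -
      let ?u = "\<lambda>j. X k x j - proj J (S k) (X k x) j"
      \<comment> \<open>Subtracting the projection removes block \<open>k\<close>; the earlier
        blocks were absent already. The residual therefore lies in the kernel of
        \<open>b k\<close>.\<close>
      have "\<forall>l\<le>k. \<forall>g\<in>S l. cinner J g ?u = 0"
      proof (intro allI impI ballI)
        fix l g assume l: "l \<le> k" and g: "g \<in> S l"
        have "g \<in> ?U" using l g k by auto
        moreover have "S k \<subseteq> ?U" using k by blast
        ultimately have pg: "cinner J g (proj J (S k) (X k x)) = (if g \<in> S k then cinner J g (X k x) else 0)"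
          by (intro cinner_proj_member[OF S(3) finU])
        show "cinner J g ?u = 0"
        proof (cases "l = k")
          case True
          then show ?thesis using pg g by (simp add: cinner_diff_right)
        next
          case False
          then have "g \<notin> S k"
            using S(2) l k g disjoint_family_onD[of S "{..<N}" l k] by auto
          moreover have "cinner J g (X k x) = 0"
            using low[of l g x] False l g that by simp
          ultimately show ?thesis using pg by (simp add: cinner_diff_right)
        qed
      qed
      then have "cinner J (\<lambda>j. cnj (b k y j)) ?u = 0"
        using S(4)[OF k, of ?u] that unfolding R_def by blast
      then show ?thesis
        by (simp add: row right_diff_distrib sum_subtractf)
    qed
    have "\<epsilon> \<le> (\<Sum>x\<in>A. sqnorm B (\<lambda>y. \<Sum>j\<in>J. b k y j * proj J (S k) (X k x) j))"
      using diag[OF k] kill by (simp add: sqnorm_def flip: bX)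
    \<comment> \<open>Two norm bounds in succession: first \<open>b k\<close> acting on the
      projected vectors, then, in the coordinates given by \<open>S k\<close>, \<open>a k\<close>
      acting on the coefficients of \<open>\<Psi>\<close>.\<close>
    also have "\<dots> \<le> (\<Sum>x\<in>A. KB * sqnorm J (proj J (S k) (X k x)))"
      by (rule sum_mono, rule op_boundD, rule b, rule k)
    also have "\<dots> = KB * (\<Sum>x\<in>A. \<Sum>g\<in>S k. (cmod (\<Sum>i\<in>I. a k x i * cinner J g (\<Psi> i)))\<^sup>2)"
      by (simp only: sqnorm_proj[OF orth[OF k] S(1)[OF k]] gX sum_distrib_left)
    also have "\<dots> = KB * (\<Sum>g\<in>S k. sqnorm A (\<lambda>x. \<Sum>i\<in>I. a k x i * cinner J g (\<Psi> i)))"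
      unfolding sqnorm_def by (subst sum.swap) (rule refl)
    also have "\<dots> \<le> KB * (\<Sum>g\<in>S k. KA * sqnorm I (\<lambda>i. cinner J g (\<Psi> i)))"
      by (rule mult_left_mono[OF _ K(2)], rule sum_mono, rule op_boundD, rule a, rule k)
    also have "\<dots> = KA * KB * (\<Sum>g\<in>S k. \<Sum>i\<in>I. (cmod (cinner J g (\<Psi> i)))\<^sup>2)"
      by (simp add: sqnorm_def sum_distrib_left mult_ac)
    finally show ?thesis .
  qed
  have "real N * \<epsilon> \<le> (\<Sum>k<N. KA * KB * (\<Sum>g\<in>S k. \<Sum>i\<in>I. (cmod (cinner J g (\<Psi> i)))\<^sup>2))"
    using sum_mono[of "{..<N}" "\<lambda>_. \<epsilon>"] step by simp
  also have "\<dots> = KA * KB * (\<Sum>g\<in>?U. \<Sum>i\<in>I. (cmod (cinner J g (\<Psi> i)))\<^sup>2)"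
    using S(1,2) by (subst sum.UNION_disjoint_family) (auto simp: sum_distrib_left)
  also have "\<dots> = KA * KB * (\<Sum>i\<in>I. \<Sum>g\<in>?U. (cmod (cinner J g (\<Psi> i)))\<^sup>2)"
    by (subst sum.swap) (rule refl)
  also have "\<dots> \<le> KA * KB * (\<Sum>i\<in>I. sqnorm J (\<Psi> i))"
    using K by (intro mult_left_mono sum_mono bessel S(3) finU) auto
  finally show ?thesis .
qed

section \<open>Joint basis states\<close>

lemma finite_basis: "finite S \<Longrightarrow> finite (basis d S)"
  by (simp add: basis_def finite_PiE)

lemma basis_iff: "c \<in> basis d S \<longleftrightarrow> (\<forall>r\<in>S. c r < d r) \<and> (\<forall>r. r \<notin> S \<longrightarrow> c r = undefined)"
  by (auto simp: basis_def PiE_def Pi_def extensional_def)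

lemma restrict_basis: "c \<in> basis d S \<Longrightarrow> T \<subseteq> S \<Longrightarrow> restrict c T \<in> basis d T"
  by (auto simp: basis_iff)

lemma basis_less: "c \<in> basis d S \<Longrightarrow> r \<in> S \<Longrightarrow> c r < d r"
  by (simp add: basis_iff)

lemma override_on_restrict:
  assumes "c \<in> basis d (S \<union> T)"
  shows "override_on (restrict c S) (restrict c T) T = c"
proof
  fix r
  show "override_on (restrict c S) (restrict c T) T r = c r"
    using assms by (cases "r \<in> T"; cases "r \<in> S") (simp_all add: basis_iff override_on_def)
qed

lemma restrict_override_on:
  assumes "a \<in> basis d S" "b \<in> basis d T" "S \<inter> T = {}"
  shows "restrict (override_on a b T) S = a" "restrict (override_on a b T) T = b"
proof -
  show "restrict (override_on a b T) S = a"
  proof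
    fix r
    show "restrict (override_on a b T) S r = a r"
      using assms by (cases "r \<in> S") (auto simp: basis_iff override_on_def)
  qed
  show "restrict (override_on a b T) T = b"
  proof
    fix r
    show "restrict (override_on a b T) T r = b r"
      using assms by (cases "r \<in> T") (auto simp: basis_iff override_on_def)
  qed
qed

lemma sum_basis_Un:
  assumes "S \<inter> T = {}"
  shows "(\<Sum>c\<in>basis d (S \<union> T). f (restrict c S) (restrict c T)) =
    (\<Sum>a\<in>basis d S. \<Sum>b\<in>basis d T. f a b)"
  unfolding sum.cartesian_product
proof (rule sum.reindex_bij_witness[where
      i = "\<lambda>(a, b). override_on a b T" and j = "\<lambda>c. (restrict c S, restrict c T)"])
  fix c assume c: "c \<in> basis d (S \<union> T)"
  show "(case (restrict c S, restrict c T) of (a, b) \<Rightarrow> override_on a b T) = c"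
    using override_on_restrict[OF c] by simp
  show "(restrict c S, restrict c T) \<in> basis d S \<times> basis d T"
    using restrict_basis[OF c] by simp
next
  fix p assume "p \<in> basis d S \<times> basis d T"
  then obtain a b where p: "p = (a, b)" "a \<in> basis d S" "b \<in> basis d T" by auto
  show "(restrict (case p of (a, b) \<Rightarrow> override_on a b T) S,
      restrict (case p of (a, b) \<Rightarrow> override_on a b T) T) = p"
    using restrict_override_on[OF p(2,3) assms] p(1) by simp
  show "(case p of (a, b) \<Rightarrow> override_on a b T) \<in> basis d (S \<union> T)"
    using p by (auto simp: basis_iff override_on_def)
qed simp

lemma sum_basis_insert:
  assumes "r \<notin> T"
  shows "(\<Sum>c\<in>basis d (insert r T). f (c r) (restrict c T)) =
    (\<Sum>k<d r. \<Sum>b\<in>basis d T. f k b)"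
  unfolding sum.cartesian_product
proof (rule sum.reindex_bij_witness[where
      i = "\<lambda>(k, b). b(r := k)" and j = "\<lambda>c. (c r, restrict c T)"])
  fix c assume c: "c \<in> basis d (insert r T)"
  have "(restrict c T)(r := c r) = c"
    using c by (intro ext) (simp add: basis_iff)
  then show "(case (c r, restrict c T) of (k, b) \<Rightarrow> b(r := k)) = c"
    by simp
  show "(c r, restrict c T) \<in> {..<d r} \<times> basis d T"
    using restrict_basis[OF c, of T] basis_less[OF c, of r] by auto
next
  fix p assume "p \<in> {..<d r} \<times> basis d T"
  then obtain k b where p: "p = (k, b)" "k < d r" "b \<in> basis d T" by auto
  have "restrict (b(r := k)) T = b"
    using p(3) assms by (intro ext) (auto simp: basis_iff)
  then show "((case p of (k, b) \<Rightarrow> b(r := k)) r, restrict (case p of (k, b) \<Rightarrow> b(r := k)) T) = p"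
    using p by simp
  show "(case p of (k, b) \<Rightarrow> b(r := k)) \<in> basis d (insert r T)"
    using p by (auto simp: basis_iff)
qed simp

lemma override_on_basis:
  assumes "c \<in> basis d (S \<union> T)" "b \<in> basis d S" "S \<inter> T = {}"
  shows "override_on c b S \<in> basis d (S \<union> T)"
    "restrict (override_on c b S) S = b" "restrict (override_on c b S) T = restrict c T"
proof -
  show "override_on c b S \<in> basis d (S \<union> T)"
    using assms by (auto simp: basis_iff override_on_def)
  show "restrict (override_on c b S) S = b"
  proof
    fix r
    show "restrict (override_on c b S) S r = b r"
      using assms by (cases "r \<in> S") (auto simp: basis_iff override_on_def)
  qed
  show "restrict (override_on c b S) T = restrict c T"
  proof
    fix r
    show "restrict (override_on c b S) T r = restrict c T r"
      using assms(3) by (cases "r \<in> T") (auto simp: override_on_def)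
  qed
qed

text \<open>Orthonormality of the columns collapses the expanded double sum to its diagonal.\<close>

lemma unitary_sqnorm:
  assumes "finite C" "unitary_on C U"
  shows "sqnorm C (\<lambda>i. \<Sum>j\<in>C. U i j * w j) = sqnorm C w"
proof -
  have "complex_of_real (sqnorm C (\<lambda>i. \<Sum>j\<in>C. U i j * w j))
      = (\<Sum>i\<in>C. \<Sum>j\<in>C. \<Sum>k\<in>C. (cnj (w j) * w k) * (cnj (U i j) * U i k))"
    by (simp only: of_real_sqnorm cinner_def cnj_sum sum_product complex_cnj_mult) (simp only: mult_ac)
  also have "\<dots> = (\<Sum>j\<in>C. \<Sum>i\<in>C. \<Sum>k\<in>C. (cnj (w j) * w k) * (cnj (U i j) * U i k))"
    by (rule sum.swap)
  also have "\<dots> = (\<Sum>j\<in>C. \<Sum>k\<in>C. (cnj (w j) * w k) * (\<Sum>i\<in>C. cnj (U i j) * U i k))"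
    unfolding sum_distrib_left by (rule sum.cong[OF refl], rule sum.swap)
  also have "\<dots> = (\<Sum>j\<in>C. \<Sum>k\<in>C. if j = k then cnj (w j) * w k else 0)"
    using assms(2) by (intro sum.cong refl) (auto simp: unitary_on_def)
  also have "\<dots> = complex_of_real (sqnorm C w)"
    using assms(1) by (simp add: of_real_sqnorm cinner_def)
  finally show ?thesis using of_real_eq_iff by blast
qed

section \<open>Eliminating the communication\<close>

text \<open>A transferred qubit is replaced by one half each of an unnormalised maximally entangled pair,
  whose basis label is put in front of the list component of the index.\<close>

type_synonym index = "(nat \<Rightarrow> nat) \<times> nat list"

definition push :: "nat \<Rightarrow> index \<Rightarrow> index" where
  "push k i = (fst i, k # snd i)"

definition pop :: "index \<Rightarrow> index" where
  "pop p = (fst p, tl (snd p))"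

definition top_label :: "index \<Rightarrow> nat" where
  "top_label p = hd (snd p)"

definition push_all :: "index set \<Rightarrow> index set" where
  "push_all I = (\<lambda>(k, i). push k i) ` ({..<2} \<times> I)"

lemma pop_push [simp]: "pop (push k i) = i" "top_label (push k i) = k"
  by (simp_all add: pop_def push_def top_label_def)

lemma finite_push_all [simp]: "finite I \<Longrightarrow> finite (push_all I)"
  by (simp add: push_all_def)

lemma sum_push_all: "(\<Sum>p\<in>push_all I. f p) = (\<Sum>k<2. \<Sum>i\<in>I. f (push k i))"
proof -
  have "inj_on (\<lambda>(k, i). push k i) ({..<2} \<times> I)"
    by (auto simp: inj_on_def push_def prod_eq_iff)
  then show ?thesis
    by (simp add: push_all_def sum.reindex sum.cartesian_product case_prod_unfold)
qed

lemma sqnorm_push_all: "sqnorm (push_all I) u = (\<Sum>k<2. sqnorm I (\<lambda>i. u (push k i)))"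
  by (simp add: sqnorm_def sum_push_all)

lemma cmod_add_squared_le: "(cmod (x + y))\<^sup>2 \<le> 2 * ((cmod x)\<^sup>2 + (cmod y)\<^sup>2)"
proof -
  have "(cmod (x + y))\<^sup>2 \<le> (cmod x + cmod y)\<^sup>2"
    by (intro power_mono norm_triangle_ineq) simp
  also have "\<dots> \<le> 2 * ((cmod x)\<^sup>2 + (cmod y)\<^sup>2)"
    using sum_squares_bound[of "cmod x" "cmod y"] by (simp add: power2_sum)
  finally show ?thesis .
qed

text \<open>\<open>top_label p\<close> is the value onto which the outgoing qubit is projected.
  Adding the contributions of the two labels costs a factor 2 in squared norm; the unitary and the
  restriction to some of its output entries cost nothing.\<close>

lemma op_bound_send:
  assumes "finite S" "r \<in> S" "d r = 2" "unitary_on (basis d S) U"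
    and M: "op_bound (basis d S) I M K"
  shows "op_bound (basis d (S - {r})) (push_all I)
    (\<lambda>a p. \<Sum>b\<in>basis d S. U (a(r := top_label p)) b * M b (pop p)) (2 * K)"
  unfolding op_bound_def
proof
  fix u :: "index \<Rightarrow> complex"
  define v where "v = (\<lambda>k b. \<Sum>i\<in>I. M b i * u (push k i))"
  define w where "w = (\<lambda>k c. \<Sum>b\<in>basis d S. U c b * v k b)"
  have sum_w: "(\<Sum>p\<in>push_all I. (\<Sum>b\<in>basis d S. U (a(r := top_label p)) b * M b (pop p)) * u p)
      = (\<Sum>k<2. w k (a(r := k)))" for a
    unfolding sum_push_all w_def v_def sum_distrib_left sum_distrib_right
    by (intro sum.cong refl) (subst sum.swap, simp add: mult.assoc)
  \<comment> \<open>Fixing register \<open>r\<close> to \<open>k\<close> picks out some of the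
    entries of \<open>w k\<close>.\<close>
  have emb: "(\<Sum>a\<in>basis d (S - {r}). (cmod (w k (a(r := k))))\<^sup>2) \<le> sqnorm (basis d S) (w k)"
    if "k < 2" for k
  proof -
    have "inj_on (\<lambda>a. a(r := k)) (basis d (S - {r}))"
    proof (rule inj_onI)
      fix a a' assume a: "a \<in> basis d (S - {r})" "a' \<in> basis d (S - {r})" "a(r := k) = a'(r := k)"
      \<comment> \<open>Both states take the default value \<open>undefined\<close> at
        \<open>r\<close>, which lies outside \<open>S - {r}\<close>.\<close>
      have "a r = a' r" using a(1,2) by (simp add: basis_iff)
      then show "a = a'" using a(3) by (metis fun_upd_triv fun_upd_upd)
    qed
    then have "(\<Sum>a\<in>basis d (S - {r}). (cmod (w k (a(r := k))))\<^sup>2)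
        = (\<Sum>c\<in>(\<lambda>a. a(r := k)) ` basis d (S - {r}). (cmod (w k c))\<^sup>2)"
      by (simp add: sum.reindex)
    also have "\<dots> \<le> sqnorm (basis d S) (w k)"
      unfolding sqnorm_def
    proof (rule sum_mono2)
      show "finite (basis d S)" using assms(1) by (rule finite_basis)
      show "(\<lambda>a. a(r := k)) ` basis d (S - {r}) \<subseteq> basis d S"
        using assms(2,3) that by (auto simp: basis_iff)
    qed simp
    finally show ?thesis .
  qed
  have "sqnorm (basis d (S - {r})) (\<lambda>a. \<Sum>k<2. w k (a(r := k)))
      \<le> (\<Sum>a\<in>basis d (S - {r}). 2 * (\<Sum>k<2. (cmod (w k (a(r := k))))\<^sup>2))"
    unfolding sqnorm_def
    by (rule sum_mono) (use cmod_add_squared_le in \<open>simp add: numeral_2_eq_2\<close>)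
  also have "\<dots> = 2 * (\<Sum>k<2. \<Sum>a\<in>basis d (S - {r}). (cmod (w k (a(r := k))))\<^sup>2)"
    unfolding sum_distrib_left[symmetric] by (subst sum.swap) (rule refl)
  also have "\<dots> \<le> 2 * (\<Sum>k<2. sqnorm (basis d S) (w k))"
    using emb by (intro mult_left_mono sum_mono) auto
  also have "\<dots> = 2 * (\<Sum>k<2. sqnorm (basis d S) (v k))"
    using unitary_sqnorm[OF finite_basis[OF assms(1)] assms(4)] by (simp add: w_def)
  also have "\<dots> \<le> 2 * (\<Sum>k<2. K * sqnorm I (\<lambda>i. u (push k i)))"
    unfolding v_def by (rule mult_left_mono, rule sum_mono, rule op_boundD, rule M, simp)
  finally show "sqnorm (basis d (S - {r})) (\<lambda>a. \<Sum>p\<in>push_all I.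
      (\<Sum>b\<in>basis d S. U (a(r := top_label p)) b * M b (pop p)) * u p) \<le> 2 * K * sqnorm (push_all I) u"
    by (simp add: sum_w sqnorm_push_all sum_distrib_left mult.assoc)
qed

text \<open>The received qubit carries the label of the pair, so the matrix is block diagonal with
  two copies of \<open>M\<close>, which leaves the bound unchanged.\<close>

lemma op_bound_receive:
  assumes "r \<notin> T" "d r = 2" and M: "op_bound (basis d T) J M K"
  shows "op_bound (basis d (insert r T)) (push_all J)
    (\<lambda>b p. if b r = top_label p then M (restrict b T) (pop p) else 0) K"
  unfolding op_bound_def
proof
  fix u :: "index \<Rightarrow> complex"
  define v where "v = (\<lambda>k b. \<Sum>j\<in>J. M b j * u (push k j))"
  have "(\<Sum>p\<in>push_all J. (if b r = top_label p then M (restrict b T) (pop p) else 0) * u p)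
      = v (b r) (restrict b T)" if "b \<in> basis d (insert r T)" for b
  proof -
    have "b r < 2" using basis_less[OF that, of r] assms(2) by simp
    have "(\<Sum>p\<in>push_all J. (if b r = top_label p then M (restrict b T) (pop p) else 0) * u p)
        = (\<Sum>k<2. if b r = k then v k (restrict b T) else 0)"
      unfolding sum_push_all v_def by (intro sum.cong refl) auto
    with \<open>b r < 2\<close> show ?thesis by simp
  qed
  then have "sqnorm (basis d (insert r T)) (\<lambda>b. \<Sum>p\<in>push_all J.
        (if b r = top_label p then M (restrict b T) (pop p) else 0) * u p)
      = (\<Sum>b\<in>basis d (insert r T). (cmod (v (b r) (restrict b T)))\<^sup>2)"
    by (simp add: sqnorm_def)
  also have "\<dots> = (\<Sum>k<2. sqnorm (basis d T) (v k))"
    using sum_basis_insert[OF assms(1), where d = d and f = "\<lambda>k b. (cmod (v k b))\<^sup>2"]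
    by (simp add: assms(2) sqnorm_def)
  also have "\<dots> \<le> (\<Sum>k<2. K * sqnorm J (\<lambda>j. u (push k j)))"
    unfolding v_def by (rule sum_mono, rule op_boundD, rule M)
  finally show "sqnorm (basis d (insert r T)) (\<lambda>b. \<Sum>p\<in>push_all J.
      (if b r = top_label p then M (restrict b T) (pop p) else 0) * u p) \<le> K * sqnorm (push_all J) u"
    by (simp add: sqnorm_push_all sum_distrib_left)
qed

text \<open>This is \<open>(A\<^sub>x \<otimes> B\<^sub>y) \<Psi>\<close> in coordinates, with
  \<open>\<Psi>\<close> and the bounds \<open>KA\<close>, \<open>KB\<close> common to all
  inputs.\<close>

definition factors_via ::
    "(nat \<Rightarrow> nat) \<Rightarrow> nat set \<Rightarrow> nat set \<Rightarrow> 'x set \<Rightarrow> 'y set \<Rightarrow> ('x \<Rightarrow> 'y \<Rightarrow> state) \<Rightarrow> index set \<Rightarrow> index set \<Rightarrow>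
     ('x \<Rightarrow> (nat \<Rightarrow> nat) \<Rightarrow> index \<Rightarrow> complex) \<Rightarrow> ('y \<Rightarrow> (nat \<Rightarrow> nat) \<Rightarrow> index \<Rightarrow> complex) \<Rightarrow>
     (index \<Rightarrow> index \<Rightarrow> complex) \<Rightarrow> real \<Rightarrow> real \<Rightarrow> bool" where
  "factors_via d S T X Y \<phi> I J A B \<Psi> KA KB \<longleftrightarrow>
     finite I \<and> finite J \<and> 0 \<le> KA \<and> 0 \<le> KB \<and>
     (\<forall>x\<in>X. op_bound (basis d S) I (A x) KA) \<and>
     (\<forall>y\<in>Y. op_bound (basis d T) J (B y) KB) \<and>
     (\<forall>x\<in>X. \<forall>y\<in>Y. \<forall>c\<in>basis d (S \<union> T).
        \<phi> x y c = (\<Sum>i\<in>I. \<Sum>j\<in>J. A x (restrict c S) i * B y (restrict c T) j * \<Psi> i j))"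

text \<open>Only the product of the three quantities is tracked, since it is what
  \<open>triangular_bound\<close> delivers as upper bound. The fixed type \<open>index\<close> lets
  the existential cover the index sets of every round, whatever the number of labels.\<close>

definition factors ::
    "(nat \<Rightarrow> nat) \<Rightarrow> nat set \<Rightarrow> nat set \<Rightarrow> 'x set \<Rightarrow> 'y set \<Rightarrow> ('x \<Rightarrow> 'y \<Rightarrow> state) \<Rightarrow> real \<Rightarrow> bool" where
  "factors d S T X Y \<phi> K \<longleftrightarrow>
     (\<exists>I J A B \<Psi> KA KB. factors_via d S T X Y \<phi> I J A B \<Psi> KA KB \<and>
        KA * KB * (\<Sum>i\<in>I. sqnorm J (\<Psi> i)) \<le> K)"

lemma factors_viaD:
  assumes "factors_via d S T X Y \<phi> I J A B \<Psi> KA KB"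
  shows "finite I" "finite J" "0 \<le> KA" "0 \<le> KB"
    "x \<in> X \<Longrightarrow> op_bound (basis d S) I (A x) KA"
    "y \<in> Y \<Longrightarrow> op_bound (basis d T) J (B y) KB"
    "x \<in> X \<Longrightarrow> y \<in> Y \<Longrightarrow> c \<in> basis d (S \<union> T) \<Longrightarrow>
      \<phi> x y c = (\<Sum>i\<in>I. \<Sum>j\<in>J. A x (restrict c S) i * B y (restrict c T) j * \<Psi> i j)"
  using assms by (simp_all add: factors_via_def)

lemma factorsE:
  assumes "factors d S T X Y \<phi> K"
  obtains I J A B \<Psi> KA KB where "factors_via d S T X Y \<phi> I J A B \<Psi> KA KB"
    "KA * KB * (\<Sum>i\<in>I. sqnorm J (\<Psi> i)) \<le> K"
  using assms unfolding factors_def by blast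

text \<open>Exchanging the parties allows projection and transmission to be treated for the left
  party only.\<close>

lemma factors_swap:
  assumes "factors d S T X Y \<phi> K"
  shows "factors d T S Y X (\<lambda>y x. \<phi> x y) K"
proof -
  obtain I J A B \<Psi> KA KB where F: "factors_via d S T X Y \<phi> I J A B \<Psi> KA KB"
    and K: "KA * KB * (\<Sum>i\<in>I. sqnorm J (\<Psi> i)) \<le> K"
    using assms by (rule factorsE)
  have "factors_via d T S Y X (\<lambda>y x. \<phi> x y) J I B A (\<lambda>j i. \<Psi> i j) KB KA"
    unfolding factors_via_def
  proof (intro conjI ballI)
    fix x y c assume "y \<in> Y" "x \<in> X" "c \<in> basis d (T \<union> S)"
    then show "\<phi> x y c = (\<Sum>j\<in>J. \<Sum>i\<in>I. B y (restrict c T) j * A x (restrict c S) i * \<Psi> i j)"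
      by (subst sum.swap) (simp add: factors_viaD(7)[OF F] Un_commute mult_ac)
  qed (use factors_viaD[OF F] in auto)
  moreover have "KB * KA * (\<Sum>j\<in>J. sqnorm I (\<lambda>i. \<Psi> i j)) \<le> K"
    using K unfolding sqnorm_def by (subst sum.swap) (simp add: mult_ac)
  ultimately show ?thesis unfolding factors_def by blast
qed

text \<open>The condition on \<open>r\<close> can be absorbed into the rows of \<open>A\<close>, and
  replacing rows by zero cannot increase the norm.\<close>

lemma factors_project:
  assumes "factors d S T X Y \<phi> K" "r \<in> S"
  shows "factors d S T X Y (\<lambda>x y c. if c r = 1 then \<phi> x y c else 0) K"
proof -
  obtain I J A B \<Psi> KA KB where F: "factors_via d S T X Y \<phi> I J A B \<Psi> KA KB"
    and K: "KA * KB * (\<Sum>i\<in>I. sqnorm J (\<Psi> i)) \<le> K"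
    using assms(1) by (rule factorsE)
  define A' where "A' = (\<lambda>x a i. if a r = 1 then A x a i else 0)"
  have "factors_via d S T X Y (\<lambda>x y c. if c r = 1 then \<phi> x y c else 0) I J A' B \<Psi> KA KB"
    unfolding factors_via_def
  proof (intro conjI ballI)
    fix x assume x: "x \<in> X"
    show "op_bound (basis d S) I (A' x) KA"
      unfolding op_bound_def
    proof
      fix u
      have "sqnorm (basis d S) (\<lambda>a. \<Sum>i\<in>I. A' x a i * u i)
          \<le> sqnorm (basis d S) (\<lambda>a. \<Sum>i\<in>I. A x a i * u i)"
        unfolding sqnorm_def
      proof (rule sum_mono)
        fix a
        show "(cmod (\<Sum>i\<in>I. A' x a i * u i))\<^sup>2 \<le> (cmod (\<Sum>i\<in>I. A x a i * u i))\<^sup>2"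
          by (cases "a r = 1") (simp_all add: A'_def)
      qed
      also have "\<dots> \<le> KA * sqnorm I u"
        using factors_viaD(5)[OF F x] by (rule op_boundD)
      finally show "sqnorm (basis d S) (\<lambda>a. \<Sum>i\<in>I. A' x a i * u i) \<le> KA * sqnorm I u" .
    qed
    fix y c assume y: "y \<in> Y" "c \<in> basis d (S \<union> T)"
    show "(if c r = 1 then \<phi> x y c else 0)
        = (\<Sum>i\<in>I. \<Sum>j\<in>J. A' x (restrict c S) i * B y (restrict c T) j * \<Psi> i j)"
      using factors_viaD(7)[OF F x y] assms(2) by (simp add: A'_def)
  qed (use factors_viaD[OF F] in auto)
  with K show ?thesis unfolding factors_def by blast
qed

text \<open>The factor 4 has two sources: the sender's bound doubles, and the squared norm of
  \<open>\<Psi>\<close> doubles because the pair is unnormalised.\<close>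

lemma factors_send:
  assumes "factors d S T X Y \<phi> K" and S: "finite S" "r \<in> S" "S \<inter> T = {}" and d: "d r = 2"
    and U: "\<And>x. x \<in> X \<Longrightarrow> unitary_on (basis d S) (U x)"
  shows "factors d (S - {r}) (insert r T) X Y (\<lambda>x y. apply_gate d S (U x) (\<phi> x y)) (4 * K)"
proof -
  obtain I J A B \<Psi> KA KB where F: "factors_via d S T X Y \<phi> I J A B \<Psi> KA KB"
    and K: "KA * KB * (\<Sum>i\<in>I. sqnorm J (\<Psi> i)) \<le> K"
    using assms(1) by (rule factorsE)
  define A' where "A' = (\<lambda>x a p. \<Sum>b\<in>basis d S. U x (a(r := top_label p)) b * A x b (pop p))"
  define B' where "B' = (\<lambda>y b p. if b r = top_label p then B y (restrict b T) (pop p) else 0)"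
  \<comment> \<open>\<open>\<Psi>\<close> tensored with the unnormalised pair, whose amplitude is 1
    on equal labels.\<close>
  define \<Psi>' where "\<Psi>' = (\<lambda>p q. if top_label p = top_label q then \<Psi> (pop p) (pop q) else 0)"
  have r: "r \<notin> T" using S by blast
  have "factors_via d (S - {r}) (insert r T) X Y (\<lambda>x y. apply_gate d S (U x) (\<phi> x y))
      (push_all I) (push_all J) A' B' \<Psi>' (2 * KA) KB"
    unfolding factors_via_def
  proof (intro conjI ballI)
    fix x assume x: "x \<in> X"
    show "op_bound (basis d (S - {r})) (push_all I) (A' x) (2 * KA)"
      unfolding A'_def by (rule op_bound_send[where U = "U x", OF S(1,2) d U[OF x] factors_viaD(5)[OF F x]])
  next
    fix y assume y: "y \<in> Y"
    show "op_bound (basis d (insert r T)) (push_all J) (B' y) KB"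
      unfolding B'_def by (rule op_bound_receive[OF r d factors_viaD(6)[OF F y]])
  next
    fix x y c assume x: "x \<in> X" and y: "y \<in> Y" and "c \<in> basis d (S - {r} \<union> insert r T)"
    moreover have "S - {r} \<union> insert r T = S \<union> T" using S by blast
    ultimately have c: "c \<in> basis d (S \<union> T)" by simp
    have "c r < 2" using basis_less[OF c, of r] S(2) d by simp
    \<comment> \<open>The sender no longer holds \<open>r\<close>, but the label \<open>c r\<close>
      restores its value in the row index of the gate.\<close>
    have cS: "(restrict c (S - {r}))(r := c r) = restrict c S"
      using S(2) by (auto simp: fun_eq_iff)
    have cT: "insert r T \<inter> T = T" by blast
    \<comment> \<open>\<open>\<Psi>'\<close> forces the two labels to agree, and \<open>B'\<close>
      forces the common label to be \<open>c r\<close>; a single label remains, with no normalising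
      factor.\<close>
    have "(\<Sum>p\<in>push_all I. \<Sum>q\<in>push_all J.
          A' x (restrict c (S - {r})) p * B' y (restrict c (insert r T)) q * \<Psi>' p q)
        = (\<Sum>k<2. \<Sum>i\<in>I. \<Sum>l<2. if l = k then \<Sum>j\<in>J.
            A' x (restrict c (S - {r})) (push k i) *
              B' y (restrict c (insert r T)) (push k j) * \<Psi> i j else 0)"
      unfolding sum_push_all by (intro sum.cong refl) (auto simp: \<Psi>'_def)
    also have "\<dots> = (\<Sum>k<2. if k = c r then
        \<Sum>i\<in>I. \<Sum>j\<in>J. A' x (restrict c (S - {r})) (push k i) * B y (restrict c T) j * \<Psi> i j else 0)"
      by (intro sum.cong refl) (auto simp: B'_def cT)
    also have "\<dots> = (\<Sum>i\<in>I. \<Sum>j\<in>J.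
        (\<Sum>b\<in>basis d S. U x (restrict c S) b * A x b i) * B y (restrict c T) j * \<Psi> i j)"
      using \<open>c r < 2\<close> by (simp add: A'_def cS insert_absorb[OF S(2)])
    also have "\<dots> = (\<Sum>i\<in>I. \<Sum>j\<in>J. \<Sum>b\<in>basis d S.
        U x (restrict c S) b * (A x b i * B y (restrict c T) j * \<Psi> i j))"
      by (simp only: sum_distrib_right mult.assoc)
    also have "\<dots> = (\<Sum>i\<in>I. \<Sum>b\<in>basis d S. \<Sum>j\<in>J.
        U x (restrict c S) b * (A x b i * B y (restrict c T) j * \<Psi> i j))"
      by (rule sum.cong[OF refl], rule sum.swap)
    also have "\<dots> = (\<Sum>b\<in>basis d S. \<Sum>i\<in>I. \<Sum>j\<in>J.
        U x (restrict c S) b * (A x b i * B y (restrict c T) j * \<Psi> i j))"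
      by (rule sum.swap)
    also have "\<dots> = (\<Sum>b\<in>basis d S. U x (restrict c S) b * \<phi> x y (override_on c b S))"
      by (intro sum.cong refl)
        (simp add: factors_viaD(7)[OF F x y] override_on_basis[OF c _ S(3)] sum_distrib_left)
    finally show "apply_gate d S (U x) (\<phi> x y) c = (\<Sum>p\<in>push_all I. \<Sum>q\<in>push_all J.
        A' x (restrict c (S - {r})) p * B' y (restrict c (insert r T)) q * \<Psi>' p q)"
      by (simp add: apply_gate_def)
  qed (use factors_viaD(1-4)[OF F] in auto)
  moreover have "(\<Sum>p\<in>push_all I. sqnorm (push_all J) (\<Psi>' p)) = 2 * (\<Sum>i\<in>I. sqnorm J (\<Psi> i))"
    by (simp add: sum_push_all sqnorm_push_all \<Psi>'_def numeral_2_eq_2 sqnorm_def)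
  then have "2 * KA * KB * (\<Sum>p\<in>push_all I. sqnorm (push_all J) (\<Psi>' p)) \<le> 4 * K"
    using K by simp
  ultimately show ?thesis unfolding factors_def by blast
qed

text \<open>The start of the induction over rounds: indices are basis states without labels, both
  operators are identity matrices, and \<open>\<Psi>\<close> is the given state split between the
  two parties.\<close>

lemma factors_const:
  assumes "finite S" "finite T" "S \<inter> T = {}"
  shows "factors d S T X Y (\<lambda>x y. \<psi>) (sqnorm (basis d (S \<union> T)) \<psi>)"
proof -
  define emb :: "(nat \<Rightarrow> nat) \<Rightarrow> index" where "emb a = (a, [])" for a
  define M where "M = (\<lambda>a (i :: index). if a = fst i then 1 else 0 :: complex)"
  define \<Psi> where "\<Psi> = (\<lambda>(i :: index) (j :: index). \<psi> (override_on (fst i) (fst j) T))"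
  have inj: "inj_on emb C" for C
    by (simp add: inj_on_def emb_def)
  note emb = sum.reindex[OF inj, unfolded o_def]
  have bound: "op_bound (basis d R) (emb ` basis d R) M 1" if "finite R" for R
    using finite_basis[OF that, of d]
    by (simp add: op_bound_def sqnorm_def emb) (simp add: M_def emb_def if_distrib[of "\<lambda>z. z * _"] cong: if_cong)
  have "factors_via d S T X Y (\<lambda>x y. \<psi>) (emb ` basis d S) (emb ` basis d T) (\<lambda>_. M) (\<lambda>_. M) \<Psi> 1 1"
    unfolding factors_via_def
  proof (intro conjI ballI)
    fix x y c assume c: "c \<in> basis d (S \<union> T)"
    have "restrict c S \<in> basis d S" "restrict c T \<in> basis d T"
      using restrict_basis[OF c] by simp_all
    moreover have "(\<Sum>i\<in>emb ` basis d S. \<Sum>j\<in>emb ` basis d T. M (restrict c S) i * M (restrict c T) j * \<Psi> i j)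
       = (\<Sum>a\<in>basis d S. if restrict c S = a then (\<Sum>b\<in>basis d T. if restrict c T = b then \<psi> (override_on a b T) else 0) else 0)"
      unfolding emb by (intro sum.cong refl) (auto simp: M_def emb_def \<Psi>_def intro!: sum.cong)
    ultimately show "\<psi> c = (\<Sum>i\<in>emb ` basis d S. \<Sum>j\<in>emb ` basis d T.
        M (restrict c S) i * M (restrict c T) j * \<Psi> i j)"
      using assms finite_basis override_on_restrict[OF c] by simp
  qed (use assms bound finite_basis in auto)
  moreover have "(\<Sum>i\<in>emb ` basis d S. sqnorm (emb ` basis d T) (\<Psi> i)) = sqnorm (basis d (S \<union> T)) \<psi>"
  proof -
    have "sqnorm (basis d (S \<union> T)) \<psi>
        = (\<Sum>c\<in>basis d (S \<union> T). (cmod (\<psi> (override_on (restrict c S) (restrict c T) T)))\<^sup>2)"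
      unfolding sqnorm_def by (intro sum.cong refl) (simp add: override_on_restrict)
    also have "\<dots> = (\<Sum>a\<in>basis d S. \<Sum>b\<in>basis d T. (cmod (\<psi> (override_on a b T)))\<^sup>2)"
      by (rule sum_basis_Un[OF assms(3), where f = "\<lambda>a b. (cmod (\<psi> (override_on a b T)))\<^sup>2"])
    finally show ?thesis by (simp add: sqnorm_def emb) (simp add: \<Psi>_def emb_def)
  qed
  ultimately show ?thesis unfolding factors_def by force
qed

text \<open>Splitting the joint basis between the parties turns squared norms of states into the
  double sums of \<open>triangular_bound\<close>; a vanishing sum of squares gives the entrywise
  zeros required there.\<close>

lemma factors_triangular:
  assumes "factors d S T X Y \<phi> K" and ST: "finite S" "finite T" "S \<inter> T = {}"
    and xy: "\<And>k. k < N \<Longrightarrow> x k \<in> X" "\<And>k. k < N \<Longrightarrow> y k \<in> Y"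
    and zero: "\<And>k l. k < N \<Longrightarrow> l < k \<Longrightarrow> sqnorm (basis d (S \<union> T)) (\<phi> (x k) (y l)) = 0"
    and diag: "\<And>k. k < N \<Longrightarrow> \<epsilon> \<le> sqnorm (basis d (S \<union> T)) (\<phi> (x k) (y k))"
  shows "real N * \<epsilon> \<le> K"
proof -
  obtain I J A B \<Psi> KA KB where F: "factors_via d S T X Y \<phi> I J A B \<Psi> KA KB"
    and K: "KA * KB * (\<Sum>i\<in>I. sqnorm J (\<Psi> i)) \<le> K"
    using assms(1) by (rule factorsE)
  note D = factors_viaD[OF F]
  have sq: "sqnorm (basis d (S \<union> T)) (\<phi> (x k) (y l)) =
      (\<Sum>a\<in>basis d S. \<Sum>b\<in>basis d T. (cmod (\<Sum>i\<in>I. \<Sum>j\<in>J. A (x k) a i * B (y l) b j * \<Psi> i j))\<^sup>2)"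
    if "k < N" "l < N" for k l
  proof -
    have "sqnorm (basis d (S \<union> T)) (\<phi> (x k) (y l)) = (\<Sum>c\<in>basis d (S \<union> T).
        (cmod (\<Sum>i\<in>I. \<Sum>j\<in>J. A (x k) (restrict c S) i * B (y l) (restrict c T) j * \<Psi> i j))\<^sup>2)"
      unfolding sqnorm_def using that xy by (intro sum.cong refl) (simp add: D(7))
    then show ?thesis
      by (simp only: sum_basis_Un[OF ST(3), where
            f = "\<lambda>a b. (cmod (\<Sum>i\<in>I. \<Sum>j\<in>J. A (x k) a i * B (y l) b j * \<Psi> i j))\<^sup>2"])
  qed
  note fin = finite_basis[OF ST(1), of d] finite_basis[OF ST(2), of d]
  have "real N * \<epsilon> \<le> KA * KB * (\<Sum>i\<in>I. sqnorm J (\<Psi> i))"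
  proof (rule triangular_bound[where a = "\<lambda>k. A (x k)" and b = "\<lambda>k. B (y k)"])
    fix k l a b assume *: "k < N" "l < k" "a \<in> basis d S" "b \<in> basis d T"
    then have "(\<Sum>a\<in>basis d S. \<Sum>b\<in>basis d T.
        (cmod (\<Sum>i\<in>I. \<Sum>j\<in>J. A (x k) a i * B (y l) b j * \<Psi> i j))\<^sup>2) = 0"
      using zero[of k l] sq[of k l] by simp
    then show "(\<Sum>i\<in>I. \<Sum>j\<in>J. A (x k) a i * B (y l) b j * \<Psi> i j) = 0"
      using * fin by (simp add: sum_nonneg_eq_0_iff sum_nonneg)
  next
    fix k assume "k < N"
    then show "\<epsilon> \<le> (\<Sum>a\<in>basis d S. \<Sum>b\<in>basis d T.
        (cmod (\<Sum>i\<in>I. \<Sum>j\<in>J. A (x k) a i * B (y k) b j * \<Psi> i j))\<^sup>2)"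
      using diag sq by simp
  qed (use fin D xy in auto)
  with K show ?thesis by linarith
qed

text \<open>The measured qubit may end up with either party; if it is on the right, the parties are
  exchanged before and after projecting.\<close>

lemma factors_project_Un:
  assumes "factors d S T X Y \<phi> K" "r \<in> S \<union> T"
  shows "factors d S T X Y (\<lambda>x y c. if c r = 1 then \<phi> x y c else 0) K"
proof (cases "r \<in> S")
  case True
  with assms(1) show ?thesis by (rule factors_project)
next
  case False
  then have "r \<in> T" using assms(2) by blast
  from factors_project[OF factors_swap[OF assms(1)] this] show ?thesis
    by (rule factors_swap)
qed

section \<open>Lower bounds for protocols\<close>

text \<open>The initial state has squared norm 1 and each round contributes a factor 4. The sample
  inputs \<open>x0\<close> and \<open>y0\<close> serve because validity states unitarity for pairs
  of inputs, whereas a gate depends on its owner's input only.\<close>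

lemma factors_run:
  assumes P: "valid_protocol X Y P" and X: "x0 \<in> X" and Y: "y0 \<in> Y" and "t \<le> rounds P"
  shows "alice_regs P t \<subseteq> registers P \<and>
    factors (reg_dim P) (alice_regs P t) (registers P - alice_regs P t) X Y (\<lambda>x y. run P x y t) (4 ^ t)"
  using assms(4)
proof (induction t)
  case 0
  have "finite (registers P)" "alice_init P \<subseteq> registers P"
    "sqnorm (basis (reg_dim P) (registers P)) (init_state P) = 1"
    using P by (simp_all add: valid_protocol_def unit_vector_on_def sqnorm_def)
  then show ?case
    using factors_const[of "alice_init P" "registers P - alice_init P" "reg_dim P" X Y "init_state P"]
    by (simp add: finite_subset Un_absorb1)
next
  case (Suc t)
  let ?d = "reg_dim P" and ?A = "alice_regs P t" and ?B = "registers P - alice_regs P t"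
  let ?r = "message P t"
  have A: "?A \<subseteq> registers P" and F: "factors ?d ?A ?B X Y (\<lambda>x y. run P x y t) (4 ^ t)"
    using Suc by auto
  have fin: "finite (registers P)" and t: "?r \<in> sender_regs P t" "?d ?r = 2"
    and U: "\<And>x y. x \<in> X \<Longrightarrow> y \<in> Y \<Longrightarrow> unitary_on (basis ?d (sender_regs P t)) (round_gate P x y t)"
    using P Suc.prems by (simp_all add: valid_protocol_def)
  have dis: "?A \<inter> ?B = {}" "?B \<inter> ?A = {}" by blast+
  have finA: "finite ?A" and finB: "finite ?B"
    using A fin finite_subset by auto
  show ?case
  proof (cases "sender P t")
    case Alice
    then have r: "?r \<in> ?A" using t by (simp add: sender_regs_def)
    have "unitary_on (basis ?d ?A) (alice_gate P t x)" if "x \<in> X" for x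
      using U[OF that Y] Alice by (simp add: sender_regs_def round_gate_def)
    from factors_send[where U = "alice_gate P t", OF F finA r dis(1) t(2) this]
    have "factors ?d (?A - {?r}) (insert ?r ?B) X Y
        (\<lambda>x y. apply_gate ?d ?A (alice_gate P t x) (run P x y t)) (4 * 4 ^ t)" .
    moreover have "registers P - (?A - {?r}) = insert ?r ?B"
      using A r by blast
    ultimately show ?thesis
      using Alice A by (auto simp: sender_regs_def round_gate_def)
  next
    case Bob
    then have r: "?r \<in> ?B" using t by (simp add: sender_regs_def)
    have "unitary_on (basis ?d ?B) (bob_gate P t y)" if "y \<in> Y" for y
      using U[OF X that] Bob by (simp add: sender_regs_def round_gate_def)
    \<comment> \<open>Bob's round is Alice's with the parties exchanged.\<close>
    from factors_send[where U = "bob_gate P t", OF factors_swap[OF F] finB r dis(2) t(2) this]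
    have "factors ?d (?B - {?r}) (insert ?r ?A) Y X
        (\<lambda>y x. apply_gate ?d ?B (bob_gate P t y) (run P x y t)) (4 * 4 ^ t)" .
    then have "factors ?d (insert ?r ?A) (?B - {?r}) X Y
        (\<lambda>x y. apply_gate ?d ?B (bob_gate P t y) (run P x y t)) (4 * 4 ^ t)"
      by (rule factors_swap)
    moreover have "registers P - insert ?r ?A = ?B - {?r}"
      by blast
    ultimately show ?thesis
      using Bob A r by (auto simp: sender_regs_def round_gate_def)
  qed
qed

text \<open>The final state cut down to outcome 1 has squared norm \<open>prob_output_1\<close>:
  one-sided error makes it vanish for \<open>l < k\<close> and keeps it at least 1/2 on the
  diagonal.\<close>

lemma triangular_rounds_bound:
  fixes x :: "nat \<Rightarrow> 'x" and y :: "nat \<Rightarrow> 'y"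
  assumes P: "valid_protocol X Y P" "computes_one_sided X Y f P"
    and xy: "\<And>k. k < N \<Longrightarrow> x k \<in> X" "\<And>k. k < N \<Longrightarrow> y k \<in> Y"
    and diag: "\<And>k. k < N \<Longrightarrow> f (x k) (y k)"
    and zero: "\<And>k l. k < N \<Longrightarrow> l < k \<Longrightarrow> \<not> f (x k) (y l)"
  shows "real N / 2 \<le> 4 ^ rounds P"
\<comment> \<open>A nonempty family supplies the sample inputs \<open>x 0\<close> and
  \<open>y 0\<close> for \<open>factors_run\<close>.\<close>
proof (cases "N = 0")
  case False
  let ?q = "rounds P" and ?d = "reg_dim P"
  let ?A = "alice_regs P ?q" and ?B = "registers P - alice_regs P ?q"
  let ?r = "message P (?q - 1)"
  let ?\<phi> = "\<lambda>x y c. if c ?r = 1 then run P x y ?q c else 0"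
  have fin: "finite (registers P)" and "1 \<le> ?q"
    and "\<forall>t<?q. message P t \<in> sender_regs P t"
    using P(1) by (simp_all add: valid_protocol_def)
  then have "?r \<in> sender_regs P (?q - 1)" by simp
  have x0: "x 0 \<in> X" and y0: "y 0 \<in> Y" using xy False by simp_all
  have A: "?A \<subseteq> registers P" and F: "factors ?d ?A ?B X Y (\<lambda>x y. run P x y ?q) (4 ^ ?q)"
    using factors_run[OF P(1) x0 y0 order_refl] by auto
  \<comment> \<open>Rounds count from 0, so the last message belongs to round \<open>?q - 1\<close>;
    its register is in \<open>registers P\<close> whichever party sent it.\<close>
  have "alice_regs P (?q - 1) \<subseteq> registers P"
    using factors_run[OF P(1) x0 y0, of "?q - 1"] by simp
  then have r: "?r \<in> ?A \<union> ?B"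
    using \<open>?r \<in> sender_regs P (?q - 1)\<close> by (auto simp: sender_regs_def split: party.splits)
  have AB: "?A \<union> ?B = registers P" using A by blast
  have prob: "sqnorm (basis ?d (?A \<union> ?B)) (?\<phi> x y) = prob_output_1 P x y" for x y
  proof -
    have "finite (basis ?d (registers P))" using fin by (rule finite_basis)
    then show ?thesis
      unfolding AB sqnorm_def prob_output_1_def
      by (subst sum.inter_filter) (auto intro!: sum.cong)
  qed
  have "real N * (1 / 2) \<le> 4 ^ ?q"
  proof (rule factors_triangular[OF factors_project_Un[OF F r], where x = x and y = y])
    show "finite ?A" "finite ?B" using A fin finite_subset by auto
    show "sqnorm (basis ?d (?A \<union> ?B)) (?\<phi> (x k) (y l)) = 0" if "k < N" "l < k" for k l
      using P(2) zero[OF that] xy that unfolding prob computes_one_sided_def by auto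
    show "1 / 2 \<le> sqnorm (basis ?d (?A \<union> ?B)) (?\<phi> (x k) (y k))" if "k < N" for k
      using P(2) diag[OF that] xy that unfolding prob computes_one_sided_def by auto
  qed (use xy in auto)
  then show ?thesis by simp
qed simp

text \<open>With \<open>2 ^ n\<close> pairs and \<open>4 ^ q = 2 ^ (2 * q)\<close>, the bound for a
  protocol of \<open>q\<close> rounds becomes \<open>n \<le> 2 * q + 1\<close>.\<close>

lemma triangular_Q1_star_bound:
  fixes x :: "nat \<Rightarrow> 'x" and y :: "nat \<Rightarrow> 'y"
  assumes xy: "\<And>k. k < 2 ^ n \<Longrightarrow> x k \<in> X" "\<And>k. k < 2 ^ n \<Longrightarrow> y k \<in> Y"
    and diag: "\<And>k. k < 2 ^ n \<Longrightarrow> f (x k) (y k)"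
    and zero: "\<And>k l. k < 2 ^ n \<Longrightarrow> l < k \<Longrightarrow> \<not> f (x k) (y l)"
  shows "ereal (real n / 2 - 1 / 2) \<le> ereal_of_enat (Q1_star X Y f)"
proof -
  let ?Q = "{enat (rounds P) | P. valid_protocol X Y P \<and> computes_one_sided X Y f P}"
  show ?thesis
  proof (cases "?Q = {}")
    \<comment> \<open>Without a suitable protocol the infimum is infinite.\<close>
    case True
    then show ?thesis by (simp add: Q1_star_def Inf_enat_def)
  next
    case False
    then have "Inf ?Q \<in> ?Q"
      unfolding Inf_enat_def by (metis (mono_tags, lifting) LeastI ex_in_conv)
    then obtain P where P: "valid_protocol X Y P" "computes_one_sided X Y f P"
      and Q: "Q1_star X Y f = enat (rounds P)"
      unfolding Q1_star_def by blast
    have "real (2 ^ n) / 2 \<le> 4 ^ rounds P"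
      using xy diag zero by (rule triangular_rounds_bound[OF P])
    then have "(2::real) ^ n \<le> 2 ^ (2 * rounds P + 1)"
      by (simp add: power_mult)
    then have "n \<le> 2 * rounds P + 1"
      by (simp only: power_increasing_iff one_less_numeral_iff semiring_norm)
    then show ?thesis by (simp add: Q)
  qed
qed

section \<open>The three functions\<close>

text \<open>The \<open>map\<close> lists the least significant bit first; \<open>rev\<close> matches
  the convention of \<open>binary_value\<close>.\<close>

definition nth_bitstring :: "nat \<Rightarrow> nat \<Rightarrow> bool list" where
  "nth_bitstring n k = rev (map (bit k) [0..<n])"

lemma nth_bitstring_in: "nth_bitstring n k \<in> bitstrings n"
  by (simp add: nth_bitstring_def bitstrings_def)

lemma binary_value_nth_bitstring: "k < 2 ^ n \<Longrightarrow> binary_value (nth_bitstring n k) = k"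
  by (simp add: binary_value_def nth_bitstring_def horner_sum_bit_eq_take_bit take_bit_nat_eq_self)

text \<open>Used contrapositively for \<open>DISJ\<close>: a strictly larger value rules out bitwise
  implication.\<close>

lemma binary_value_mono:
  assumes "list_all2 (\<longrightarrow>) xs ys"
  shows "binary_value xs \<le> binary_value ys"
proof -
  have "horner_sum of_bool 2 us \<le> (horner_sum of_bool 2 vs :: nat)" if "list_all2 (\<longrightarrow>) us vs" for us vs
    using that by (induction rule: list_all2_induct) auto
  then show ?thesis
    using assms by (simp add: binary_value_def list_all2_rev)
qed

text \<open>A set misses the complement of another exactly when it is contained in that other; this
  turns disjointness into the bitwise order.\<close>

lemma DISJ_map_Not:
  assumes "length x = length y"
  shows "DISJ x (map Not y) \<longleftrightarrow> list_all2 (\<longrightarrow>) x y"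
  using assms by (auto simp: DISJ_def list_all2_conv_all_nth)

theorem corollary1:
  fixes n :: nat
  assumes "n \<ge> 1"
  shows "ereal_of_enat (Q1_star (bitstrings n) (bitstrings n) EQ) \<ge> ereal (real n / 2 - 1 / 2) \<and>
         ereal_of_enat (Q1_star (bitstrings n) (bitstrings n) DISJ) \<ge> ereal (real n / 2 - 1 / 2) \<and>
         ereal_of_enat (Q1_star (bitstrings n) (bitstrings n) GT) \<ge> ereal (real n / 2 - 1 / 2)"
proof (intro conjI)
  let ?x = "nth_bitstring n"
  \<comment> \<open>Listing the strings by value makes every earlier string strictly smaller: this
    refutes \<open>GT\<close> below the diagonal and separates the strings for
    \<open>EQ\<close>.\<close>
  have lt: "binary_value (?x l) < binary_value (?x k)" if "k < 2 ^ n" "l < k" for k l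
    using that by (simp add: binary_value_nth_bitstring)
  show "ereal (real n / 2 - 1 / 2) \<le> ereal_of_enat (Q1_star (bitstrings n) (bitstrings n) EQ)"
  proof (rule triangular_Q1_star_bound[where x = ?x and y = ?x])
    show "\<not> EQ (?x k) (?x l)" if "k < 2 ^ n" "l < k" for k l
      using lt[OF that] by (auto simp: EQ_def)
  qed (simp_all add: nth_bitstring_in EQ_def)
  show "ereal (real n / 2 - 1 / 2) \<le> ereal_of_enat (Q1_star (bitstrings n) (bitstrings n) GT)"
  proof (rule triangular_Q1_star_bound[where x = ?x and y = ?x])
    show "\<not> GT (?x k) (?x l)" if "k < 2 ^ n" "l < k" for k l
      using lt[OF that] by (simp add: GT_def)
  qed (simp_all add: nth_bitstring_in GT_def)
  have len: "length (?x k) = n" for k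
    using nth_bitstring_in[of n k] by (simp add: bitstrings_def)
  show "ereal (real n / 2 - 1 / 2) \<le> ereal_of_enat (Q1_star (bitstrings n) (bitstrings n) DISJ)"
  \<comment> \<open>Bob receives the complement: if \<open>?x k\<close> were disjoint from the
    complement of \<open>?x l\<close>, it would lie bitwise below \<open>?x l\<close>, so its value
    could not be larger.\<close>
  proof (rule triangular_Q1_star_bound[where x = ?x and y = "\<lambda>k. map Not (?x k)"])
    show "\<not> DISJ (?x k) (map Not (?x l))" if "k < 2 ^ n" "l < k" for k l
      using lt[OF that] binary_value_mono[of "?x k" "?x l"] by (auto simp: DISJ_map_Not len)
    show "DISJ (?x k) (map Not (?x k))" for k
      by (simp add: DISJ_map_Not list_all2_refl)
  qed (simp_all add: bitstrings_def len)
qed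

end
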